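(* Let $c_2\in[\frac12,1]$. Consider the two-stage EERK2 method $$U^{n,1}=u_h^{n-1},\qquad U^{n,i+1}=U^{n,1}+\sum_{j=1}^{i}a_{i+1,j}(-\tau L_\kappa)\left[\tau g_\kappa(U^{n,j})-\tau L_\kappa U^{n,1}\right]\ (i=1,2),\qquad u_h^n=U^{n,3},$$ with $a_{21}(z)=c_2\varphi_1(c_2z)$, $a_{31}(z)=\varphi_1(z)-\frac1{c_2}\varphi_2(z)$, $a_{32}(z)=\frac1{c_2}\varphi_2(z)$, where $g_h$ is Lipschitz continuous with constant $\ell_g>0$ and $\kappa\ge2\ell_g$. Then the method preserves the energy dissipation law unconditionally at all stages: for every $\tau>0$, $n\ge1$ and $j\in\{1,2\}$, $$E[U^{n,j+1}]-E[U^{n,1}]\le-\frac1\tau\sum_{k=1}^{j}\Big\langle\delta_\tau U^{n,k+1},\sum_{\ell=1}^{k}d^{(2)}_{k\ell}(c_2,-\tau L_\kappa)\,\delta_\tau U^{n,\ell+1}\Big\rangle\le0,$$ where $\delta_\tau U^{n,k+1}:=U^{n,k+1}-U^{n,k}$ and $$D^{(2)}(c_2,z)=(d^{(2)}_{k\ell}(c_2,z))=\begin{pmatrix}\frac1{c_2\varphi_1(c_2z)}+\frac z2&0\\[4pt]\frac{c_2\varphi_1(c_2z)-\varphi_1(z)+\frac1{c_2}\varphi_2(z)}{\varphi_2(z)\varphi_1(c_2z)}+z&\frac{c_2}{\varphi_2(z)}+\frac z2\end{pmatrix}.$$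
   Context: $\langle u,v\rangle=v^Tu$ and $\|v\|=\sqrt{\langle v,v\rangle}$ on $\mathbb{R}^M$; Lipschitz is with respect to $\|\cdot\|$. $L_h\in\mathbb{R}^{M\times M}$ is symmetric positive definite. $G_h\ge0$ is a non-negative Lyapunov function with $g_h(v)=-\frac{\delta}{\delta v}G_h(v)$, i.e. the gradient of the scalar function $v\mapsto\langle G_h(v),1\rangle$ is $-g_h(v)$, where $1$ is the all-ones vector. The energy is $E[v]=\frac12\langle v,L_hv\rangle+\langle G_h(v),1\rangle$. Stabilized operators: $L_\kappa:=L_h+\kappa I$, $g_\kappa(u):=g_h(u)+\kappa u$. $\varphi_0(z)=e^z$, $\varphi_{k+1}(z)=(\varphi_k(z)-1/k!)/z$ (entire functions, extended continuously to $z=0$). For a function $f$, $f(-\tau L_\kappa)$ is the matrix function defined through the spectrum of the symmetric matrix $-\tau L_\kappa$. *)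

theory Defs
  imports "HOL-Analysis.Analysis"
begin

section \<open>The functions \<open>\<phi>\<^sub>k\<close>\<close>

fun phi :: "nat \<Rightarrow> 'a::{real_normed_field,banach} \<Rightarrow> 'a" where
  "phi 0 z = exp z"
| "phi (Suc k) z = (if z = 0 then 1 / fact (Suc k) else (phi k z - 1 / fact k) / z)"

text \<open>The value at \<open>0\<close> is the continuous extension: \<open>\<phi>\<^sub>k\<close> is given by one power series everywhere.\<close>

lemma phi_sums: "(\<lambda>n. z ^ n / fact (n + k)) sums phi k z"
proof (induction k)
  case 0
  show ?case
    using exp_converges[of z] by (simp add: scaleR_conv_of_real divide_simps)
next
  case (Suc k)
  show ?case
  proof (cases "z = 0")
    case True
    have "(\<lambda>n. (1 / fact (n + Suc k)) * 0 ^ n :: 'a) sums (1 / fact (0 + Suc k))"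
      by (rule powser_sums_zero)
    then show ?thesis using True by simp
  next
    case False
    have "(\<lambda>n. z ^ Suc n / fact (Suc n + k)) sums (phi k z - 1 / fact k)"
      using Suc by (subst sums_Suc_iff) simp
    then have "(\<lambda>n. z ^ Suc n / fact (Suc n + k) / z) sums ((phi k z - 1 / fact k) / z)"
      by (rule sums_divide)
    then show ?thesis using False by simp
  qed
qed

section \<open>Functions of symmetric matrices\<close>

definition diag_mat :: "('m \<Rightarrow> real) \<Rightarrow> real^'m^'m" where
  "diag_mat d = (\<chi> i j. if i = j then d i else 0)"

definition matfun :: "(real \<Rightarrow> real) \<Rightarrow> real^'m^'m \<Rightarrow> real^'m^'m" where
  "matfun f A = (THE B. \<exists>Q d. orthogonal_matrix Q \<and> A = Q ** diag_mat d ** transpose Q \<and>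
                          B = Q ** diag_mat (\<lambda>i. f (d i)) ** transpose Q)"

text \<open>
  The description in \<open>matfun\<close> determines a unique matrix for every symmetric argument:
  the result does not depend on the chosen diagonalization (\<open>matfun_eq\<close>), and one exists
  (\<open>symmetric_diagonalizable\<close>).
\<close>

lemma mult_diag_mat:
  fixes R :: "real^'m^'m"
  shows "(R ** diag_mat d) $ i $ j = R $ i $ j * d j"
    and "(diag_mat d ** R) $ i $ j = d i * R $ i $ j"
  by (simp_all add: matrix_matrix_mult_def diag_mat_def if_distrib if_distribR cong: if_cong)

lemma matfun_eq:
  fixes Q :: "real^'m^'m"
  assumes Q: "orthogonal_matrix Q" and A: "A = Q ** diag_mat d ** transpose Q"
  shows "matfun f A = Q ** diag_mat (\<lambda>i. f (d i)) ** transpose Q"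
  unfolding matfun_def
proof (rule the_equality)
  show "\<exists>Q' d'. orthogonal_matrix Q' \<and> A = Q' ** diag_mat d' ** transpose Q' \<and>
          Q ** diag_mat (\<lambda>i. f (d i)) ** transpose Q = Q' ** diag_mat (\<lambda>i. f (d' i)) ** transpose Q'"
    using Q A by blast
next
  fix B
  assume "\<exists>P e. orthogonal_matrix P \<and> A = P ** diag_mat e ** transpose P \<and>
            B = P ** diag_mat (\<lambda>i. f (e i)) ** transpose P"
  then obtain P e where P: "orthogonal_matrix P" and A': "A = P ** diag_mat e ** transpose P"
    and B: "B = P ** diag_mat (\<lambda>i. f (e i)) ** transpose P" by blast
  have QQ: "transpose Q ** Q = mat 1" "Q ** transpose Q = mat 1"
    and PP: "transpose P ** P = mat 1" "P ** transpose P = mat 1"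
    using Q P by (auto simp: orthogonal_matrix_def)
  define R where "R = transpose P ** Q"
  have "R ** diag_mat d = transpose P ** (Q ** diag_mat d ** transpose Q) ** Q"
    unfolding R_def by (metis QQ(1) matrix_mul_assoc matrix_mul_rid)
  also have "\<dots> = diag_mat e ** R"
    unfolding A[symmetric] unfolding A' R_def by (metis PP(1) matrix_mul_assoc matrix_mul_lid)
  finally have "R $ i $ j * d j = e i * R $ i $ j" for i j
    by (metis mult_diag_mat)
  then have "R $ i $ j * f (d j) = f (e i) * R $ i $ j" for i j
    by (cases "R $ i $ j = 0") (metis mult.commute mult_cancel_right, metis mult.commute mult_cancel_right)
  then have RF: "R ** diag_mat (\<lambda>i. f (d i)) = diag_mat (\<lambda>i. f (e i)) ** R"
    by (simp add: vec_eq_iff mult_diag_mat)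
  have "B = P ** (diag_mat (\<lambda>i. f (e i)) ** R) ** transpose Q"
    unfolding B R_def by (metis QQ(2) matrix_mul_assoc matrix_mul_rid)
  also have "\<dots> = Q ** diag_mat (\<lambda>i. f (d i)) ** transpose Q"
    unfolding RF[symmetric] unfolding R_def by (metis PP(2) matrix_mul_assoc matrix_mul_lid)
  finally show "B = Q ** diag_mat (\<lambda>i. f (d i)) ** transpose Q" .
qed

lemma symmetric_eigenvector:
  fixes A :: "real^'m^'m"
  assumes sym: "transpose A = A" and S: "subspace S" "S \<noteq> {0}"
    and inv: "\<And>v. v \<in> S \<Longrightarrow> A *v v \<in> S"
  obtains v l where "v \<in> S" "norm v = 1" "A *v v = l *\<^sub>R v"
proof -
  have symi: "x \<bullet> (A *v y) = (A *v x) \<bullet> y" for x y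
    by (metis dot_lmul_matrix sym transpose_matrix_vector)
  obtain w where w: "w \<in> S" "w \<noteq> 0" using S subspace_0 by blast
  have "(1 / norm w) *\<^sub>R w \<in> S \<inter> sphere 0 1"
    using w S by (auto simp: subspace_scale)
  then have ne: "S \<inter> sphere 0 1 \<noteq> {}" by blast
  have "compact (S \<inter> sphere 0 1)"
    using S by (simp add: closed_Int_compact closed_subspace)
  moreover have "continuous_on (S \<inter> sphere 0 1) (\<lambda>x. x \<bullet> (A *v x))"
    by (intro continuous_intros matrix_vector_mult_linear_continuous_on)
  ultimately obtain v where "v \<in> S \<inter> sphere 0 1"
    and "\<And>x. x \<in> S \<inter> sphere 0 1 \<Longrightarrow> x \<bullet> (A *v x) \<le> v \<bullet> (A *v v)"
    using continuous_attains_sup[of "S \<inter> sphere 0 1" "\<lambda>x. x \<bullet> (A *v x)"] ne by blast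
  then have v: "v \<in> S" "norm v = 1"
    and max: "\<And>x. x \<in> S \<Longrightarrow> norm x = 1 \<Longrightarrow> x \<bullet> (A *v x) \<le> v \<bullet> (A *v v)"
    by auto
  define l where "l = v \<bullet> (A *v v)"
  have le: "x \<bullet> (A *v x) \<le> l * (x \<bullet> x)" if "x \<in> S" for x
  proof (cases "x = 0")
    case False
    have "((1 / norm x) *\<^sub>R x) \<bullet> (A *v ((1 / norm x) *\<^sub>R x)) \<le> l"
      unfolding l_def using that S False by (intro max) (auto simp: subspace_scale)
    then have "(x \<bullet> (A *v x)) / (norm x)\<^sup>2 \<le> l"
      by (simp add: matrix_vector_mult_scaleR power2_eq_square)
    then show ?thesis using False by (simp add: divide_simps power2_norm_eq_inner)
  qed (simp add: matrix_vector_mult_0_right)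
  define u where "u = l *\<^sub>R v - A *v v"
  define c where "c = l * (u \<bullet> u) - u \<bullet> (A *v u)"
  have uS: "u \<in> S" unfolding u_def using v inv S by (simp add: subspace_diff subspace_scale)
  have vv: "v \<bullet> v = 1" using v by (simp add: norm_eq_1)
  have ineq: "0 \<le> 2 * t * (u \<bullet> u) + t\<^sup>2 * c" for t
  proof -
    have "v + t *\<^sub>R u \<in> S" using v uS S by (simp add: subspace_add subspace_scale)
    from le[OF this] have "0 \<le> l * ((v + t *\<^sub>R u) \<bullet> (v + t *\<^sub>R u)) - (v + t *\<^sub>R u) \<bullet> (A *v (v + t *\<^sub>R u))"
      by simp
    also have "\<dots> = l * (v \<bullet> v) - v \<bullet> (A *v v) + 2 * t * (l * (v \<bullet> u) - (A *v v) \<bullet> u) + t\<^sup>2 * c"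
      unfolding c_def
      by (simp add: matrix_vector_right_distrib matrix_vector_mult_scaleR inner_add_left
          inner_add_right symi[of v u]
          inner_commute[of u v] inner_commute[of u "A *v v"] power2_eq_square algebra_simps)
    also have "\<dots> = 2 * t * (u \<bullet> u) + t\<^sup>2 * c"
      by (simp add: vv l_def[symmetric] u_def inner_diff_left)
    finally show ?thesis .
  qed
  have "u \<bullet> u \<le> 0"
  proof (rule ccontr)
    assume "\<not> u \<bullet> u \<le> 0"
    then have p: "u \<bullet> u > 0" by linarith
    define t where "t = - (u \<bullet> u) / (\<bar>c\<bar> + 1)"
    have "t < 0" using p by (simp add: t_def divide_neg_pos)
    have "t * c \<ge> - (u \<bullet> u)"
    proof -
      have "\<bar>t * c\<bar> = (u \<bullet> u) * (\<bar>c\<bar> / (\<bar>c\<bar> + 1))"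
        using p by (simp add: t_def abs_mult)
      also have "\<dots> \<le> (u \<bullet> u) * 1" using p by (intro mult_left_mono) auto
      finally show ?thesis by linarith
    qed
    then have "0 < 2 * (u \<bullet> u) + t * c" using p by linarith
    then have "t * (2 * (u \<bullet> u) + t * c) < 0" using \<open>t < 0\<close> by (simp add: mult_neg_pos)
    then show False using ineq[of t] by (simp add: algebra_simps power2_eq_square)
  qed
  then have "u = 0" by (metis inner_eq_zero_iff inner_ge_zero order_antisym)
  then have "A *v v = l *\<^sub>R v" by (simp add: u_def)
  then show thesis using that v by blast
qed

lemma symmetric_eigenbasis:
  fixes A :: "real^'m^'m"
  assumes sym: "transpose A = A" and "subspace S" and "\<And>v. v \<in> S \<Longrightarrow> A *v v \<in> S"
  shows "\<exists>B\<subseteq>S. pairwise orthogonal B \<and> card B = dim S \<and> finite B \<and>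
           (\<forall>v\<in>B. norm v = 1 \<and> (\<exists>l. A *v v = l *\<^sub>R v))"
  using assms(2,3)
proof (induction "dim S" arbitrary: S rule: less_induct)
  case (less S)
  show ?case
  proof (cases "S = {0}")
    case True
    then show ?thesis by (intro exI[of _ "{}"]) auto
  next
    case False
    then obtain v l where v: "v \<in> S" "norm v = 1" "A *v v = l *\<^sub>R v"
      using symmetric_eigenvector[OF sym, of S] less.prems by blast
    have symi: "x \<bullet> (A *v y) = (A *v x) \<bullet> y" for x y
      by (metis dot_lmul_matrix sym transpose_matrix_vector)
    define T where "T = S \<inter> {x. v \<bullet> x = 0}"
    have subT: "subspace T"
      unfolding T_def using less.prems(1) by (simp add: subspace_inter subspace_hyperplane)
    have invT: "A *v x \<in> T" if "x \<in> T" for x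
      using that less.prems(2) v(3) by (auto simp: T_def symi)
    have "v \<noteq> 0" using v by auto
    have "S = {x + y |x y. x \<in> span {v} \<and> y \<in> T}" (is "_ = ?R")
    proof
      show "S \<subseteq> ?R"
      proof
        fix x assume x: "x \<in> S"
        have "x - (v \<bullet> x) *\<^sub>R v \<in> T"
          using x v less.prems(1)
          by (simp add: T_def subspace_diff subspace_scale inner_diff_right norm_eq_1)
        moreover have "(v \<bullet> x) *\<^sub>R v \<in> span {v}" by (simp add: span_base span_scale)
        moreover have "x = (v \<bullet> x) *\<^sub>R v + (x - (v \<bullet> x) *\<^sub>R v)" by simp
        ultimately show "x \<in> ?R" by blast
      qed
      have "span {v} \<subseteq> S" using v less.prems(1) by (simp add: span_minimal)
      then show "?R \<subseteq> S" using less.prems(1) by (auto simp: T_def subspace_add)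
    qed
    moreover have "span {v} \<inter> T = {0}"
      using subT subspace_0 \<open>v \<noteq> 0\<close> by (auto simp: T_def span_singleton)
    ultimately have dS: "dim S = 1 + dim T"
      using dim_sums_Int[of "span {v}" T] subT \<open>v \<noteq> 0\<close> by (simp add: dim_singleton)
    then obtain B where B: "B \<subseteq> T" "pairwise orthogonal B" "card B = dim T" "finite B"
      "\<forall>v\<in>B. norm v = 1 \<and> (\<exists>l. A *v v = l *\<^sub>R v)"
      using less.hyps[of T] subT invT by auto
    have "v \<notin> B" using B(1) \<open>v \<noteq> 0\<close> by (auto simp: T_def)
    then show ?thesis
      using B v dS
      by (intro exI[of _ "insert v B"])
        (auto simp: T_def pairwise_insert orthogonal_def inner_commute subset_iff)
  qed
qed

lemma symmetric_diagonalizable: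
  fixes A :: "real^'m^'m"
  assumes sym: "transpose A = A"
  obtains Q d where "orthogonal_matrix Q" "A = Q ** diag_mat d ** transpose Q"
proof -
  obtain B where B: "pairwise orthogonal B" "card B = CARD('m)" "finite B"
      "\<forall>v\<in>B. norm v = 1 \<and> (\<exists>l. A *v v = l *\<^sub>R v)"
    using symmetric_eigenbasis[OF sym, of UNIV] by auto
  then obtain b where b: "bij_betw b (UNIV :: 'm set) B"
    by (metis finite finite_same_card_bij)
  have "\<forall>i. \<exists>l. A *v b i = l *\<^sub>R b i" using B(4) b by (meson UNIV_I bij_betwE)
  then obtain d where d: "\<And>i. A *v b i = d i *\<^sub>R b i" by metis
  have ortho: "b i \<bullet> b j = (if i = j then 1 else 0)" for i j
  proof (cases "i = j")
    case True
    then show ?thesis using B(4) b by (simp add: bij_betw_apply norm_eq_1[symmetric])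
  next
    case False
    then have "b i \<noteq> b j" using b by (meson UNIV_I bij_betw_imp_inj_on inj_on_def)
    then show ?thesis using False B(1) b by (simp add: pairwise_def orthogonal_def bij_betw_apply)
  qed
  define Q :: "real^'m^'m" where "Q = (\<chi> i j. b j $ i)"
  have "transpose Q ** Q = mat 1"
    using ortho
    by (simp add: vec_eq_iff matrix_matrix_mult_def transpose_def mat_def Q_def inner_vec_def)
  then have Q: "orthogonal_matrix Q" by (simp add: orthogonal_matrix)
  have "A ** Q = Q ** diag_mat d"
  proof -
    have "(A ** Q) $ i $ j = (A *v b j) $ i" for i j
      by (simp add: matrix_matrix_mult_def matrix_vector_mult_def Q_def)
    then show ?thesis by (simp add: vec_eq_iff mult_diag_mat d) (simp add: Q_def mult.commute)
  qed
  then have "A = Q ** diag_mat d ** transpose Q"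
    by (metis Q matrix_mul_assoc matrix_mul_rid orthogonal_matrix_def)
  with Q that show thesis by blast
qed

section \<open>The gradient flow and its discretization\<close>

definition spd :: "real^'m^'m \<Rightarrow> bool" where
  "spd A \<longleftrightarrow> transpose A = A \<and> (\<forall>v. v \<noteq> 0 \<longrightarrow> v \<bullet> (A *v v) > 0)"

definition energy :: "real^'m^'m \<Rightarrow> (real^'m \<Rightarrow> real^'m) \<Rightarrow> real^'m \<Rightarrow> real" where
  "energy L G v = 1/2 * (v \<bullet> (L *v v)) + G v \<bullet> 1"

definition L_stab :: "real^'m^'m \<Rightarrow> real \<Rightarrow> real^'m^'m" where
  "L_stab L \<kappa> = L + \<kappa> *\<^sub>R mat 1"

definition g_stab :: "(real^'m \<Rightarrow> real^'m) \<Rightarrow> real \<Rightarrow> real^'m \<Rightarrow> real^'m" where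
  "g_stab g \<kappa> u = g u + \<kappa> *\<^sub>R u"

text \<open>Coefficients \<open>a\<^sub>i\<^sub>j(z)\<close>; only \<open>(i, j) \<in> {(2,1), (3,1), (3,2)}\<close> occur in the method.\<close>

definition eerk2_a :: "real \<Rightarrow> nat \<Rightarrow> nat \<Rightarrow> real \<Rightarrow> real" where
  "eerk2_a c\<^sub>2 i j z =
     (if i = 2 \<and> j = 1 then c\<^sub>2 * phi 1 (c\<^sub>2 * z)
      else if i = 3 \<and> j = 1 then phi 1 z - 1 / c\<^sub>2 * phi 2 z
      else if i = 3 \<and> j = 2 then 1 / c\<^sub>2 * phi 2 z
      else 0)"

text \<open>\<open>u n\<close> is the numerical solution at time level \<open>n\<close> and \<open>U n i\<close> is the stage \<open>U\<^bsup>n,i\<^esup>\<close>.\<close>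

definition eerk2_solution ::
  "real^'m^'m \<Rightarrow> (real^'m \<Rightarrow> real^'m) \<Rightarrow> real \<Rightarrow> real \<Rightarrow> real \<Rightarrow>
   (nat \<Rightarrow> real^'m) \<Rightarrow> (nat \<Rightarrow> nat \<Rightarrow> real^'m) \<Rightarrow> bool" where
  "eerk2_solution L g \<kappa> c\<^sub>2 \<tau> u U \<longleftrightarrow>
     (\<forall>n\<ge>1.
        U n 1 = u (n - 1) \<and>
        (\<forall>i\<in>{1,2}. U n (i + 1) = U n 1 +
           (\<Sum>j=1..i. matfun (eerk2_a c\<^sub>2 (i + 1) j) ((- \<tau>) *\<^sub>R L_stab L \<kappa>) *v
              (\<tau> *\<^sub>R g_stab g \<kappa> (U n j) - \<tau> *\<^sub>R (L_stab L \<kappa> *v U n 1)))) \<and>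
        u n = U n 3)"

text \<open>Entries of the lower triangular matrix \<open>D\<^bsup>(2)\<^esup>(c\<^sub>2, z)\<close>, with indices in \<open>{1, 2}\<close>.\<close>

definition eerk2_d :: "real \<Rightarrow> nat \<Rightarrow> nat \<Rightarrow> real \<Rightarrow> real" where
  "eerk2_d c\<^sub>2 k l z =
     (if k = 1 \<and> l = 1 then 1 / (c\<^sub>2 * phi 1 (c\<^sub>2 * z)) + z / 2
      else if k = 2 \<and> l = 1 then
        (c\<^sub>2 * phi 1 (c\<^sub>2 * z) - phi 1 z + 1 / c\<^sub>2 * phi 2 z) / (phi 2 z * phi 1 (c\<^sub>2 * z)) + z
      else if k = 2 \<and> l = 2 then c\<^sub>2 / phi 2 z + z / 2
      else 0)"

definition stage_diff :: "(nat \<Rightarrow> real^'m) \<Rightarrow> nat \<Rightarrow> real^'m" where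
  "stage_diff V i = V i - V (i - 1)"

end

theory Submission
  imports Defs
begin

text \<open>
  The Lipschitz bound on \<open>g\<close> gives the descent lemma for the nonlinear part of the energy, and
  \<open>\<kappa> \<ge> l\<^sub>g\<close> absorbs its quadratic error. The energy change over one stage is then at most
  \<open>- 1 / \<tau>\<close> times the inner product of the stage difference with the residual
  \<open>\<tau> g\<^sub>\<kappa>(w) + Z (v + w) / 2\<close>, where \<open>Z = - \<tau> L\<^sub>\<kappa>\<close>; eliminating \<open>g\<^sub>\<kappa>\<close> by means of the
  stage equations turns the residuals into the rows of \<open>D\<close> applied to the stage differences.
  In an eigenbasis of \<open>Z\<close> the sign reduces to the scalar inequality \<open>d\<^sub>2\<^sub>1\<^sup>2 \<le> 4 d\<^sub>1\<^sub>1 d\<^sub>2\<^sub>2\<close> at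
  \<open>z = - x < 0\<close>. With \<open>p = e\<^bsup>-c x\<^esup>\<close>, \<open>q = e\<^bsup>-x\<^esup>\<close> and \<open>s = x - 1 + q\<close> that inequality reads
  \<open>s\<^sup>2 + (c x)\<^sup>2 (p - q)\<^sup>2 \<le> 2 c x s (1 - p q)\<close>, which follows from
  \<open>c x (p - q) \<le> (1 - e\<^bsup>-x/2\<^esup>)\<^sup>2 \<le> s\<close>.
\<close>

section \<open>The energy estimate\<close>

text \<open>Along the segment from \<open>w\<close> to \<open>v\<close> the function
  \<open>h\<close> is \<open>F\<close> minus its quadratic model at \<open>w\<close>. By
  Cauchy-Schwarz and the Lipschitz bound its derivative is at most 0 on the unit interval, so
  \<open>h 1 \<le> h 0\<close>.\<close>

lemma descent_lemma:
  fixes F :: "'a::real_inner \<Rightarrow> real"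
  assumes grad: "\<And>x. GDERIV F x :> f x" and lip: "l-lipschitz_on UNIV f"
  shows "F v - F w \<le> f w \<bullet> (v - w) + l / 2 * (norm (v - w))\<^sup>2"
proof -
  define d where "d = v - w"
  define h where "h t = F (w + t *\<^sub>R d) - t * (f w \<bullet> d) - l / 2 * t\<^sup>2 * (norm d)\<^sup>2" for t
  have "h 1 \<le> h 0"
  proof (rule DERIV_nonpos_imp_nonincreasing[of 0 1 h])
    fix t :: real
    assume t: "0 \<le> t" "t \<le> 1"
    have "((\<lambda>t. F (w + t *\<^sub>R d)) has_derivative (\<lambda>s. (s *\<^sub>R d) \<bullet> f (w + t *\<^sub>R d))) (at t)"
      by (rule has_derivative_compose[OF _ grad[unfolded gderiv_def]])
        (auto intro!: derivative_eq_intros)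
    moreover have "(\<lambda>s. (s *\<^sub>R d) \<bullet> f (w + t *\<^sub>R d)) = (*) (f (w + t *\<^sub>R d) \<bullet> d)"
      by (auto simp: inner_commute)
    ultimately have "((\<lambda>t. F (w + t *\<^sub>R d)) has_real_derivative f (w + t *\<^sub>R d) \<bullet> d) (at t)"
      by (simp add: has_field_derivative_def)
    then have "(h has_real_derivative f (w + t *\<^sub>R d) \<bullet> d - f w \<bullet> d - l * t * (norm d)\<^sup>2) (at t)"
      unfolding h_def by (auto intro!: derivative_eq_intros)
    moreover have "f (w + t *\<^sub>R d) \<bullet> d - f w \<bullet> d \<le> l * t * (norm d)\<^sup>2"
    proof -
      have "(f (w + t *\<^sub>R d) - f w) \<bullet> d \<le> norm (f (w + t *\<^sub>R d) - f w) * norm d"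
        by (rule norm_cauchy_schwarz)
      also have "\<dots> \<le> (l * norm (t *\<^sub>R d)) * norm d"
        using lipschitz_onD[OF lip, of "w + t *\<^sub>R d" w]
        by (intro mult_right_mono) (auto simp: dist_norm)
      finally show ?thesis using t by (simp add: inner_diff_left power2_eq_square mult_ac)
    qed
    ultimately show "\<exists>y. DERIV h t :> y \<and> y \<le> 0" by fastforce
  qed simp
  then show ?thesis by (simp add: h_def d_def)
qed

lemma inner_symmetric_matrix:
  fixes A :: "real^'m^'m"
  assumes "transpose A = A"
  shows "x \<bullet> (A *v y) = (A *v x) \<bullet> y"
  by (metis assms dot_lmul_matrix transpose_matrix_vector)

lemma L_stab_mult_vec:
  "(c *\<^sub>R L_stab L \<kappa>) *v x = c *\<^sub>R (L *v x) + (c * \<kappa>) *\<^sub>R x"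
  by (simp only: L_stab_def scaleR_right_distrib matrix_vector_mult_add_rdistrib scaleR_scaleR
      scaleR_matrix_vector_assoc[symmetric] matrix_vector_mul_lid)

text \<open>By symmetry the quadratic part changes by exactly
  \<open>(v - w) \<bullet> (L *v w)\<close> plus half of
  \<open>(v - w) \<bullet> (L *v (v - w))\<close>. The descent error \<open>l / 2\<close> is
  enlarged to \<open>\<kappa> / 2\<close>, which is just what the stabilization contributes to
  \<open>(1/2) *\<^sub>R (Z *v (v - w))\<close>; the two terms in
  \<open>\<kappa> *\<^sub>R w\<close> cancel.\<close>

lemma energy_diff_le:
  fixes L :: "real^'m^'m"
  assumes sym: "transpose L = L"
    and grad: "\<And>v. GDERIV (\<lambda>w. G w \<bullet> 1) v :> - g v"
    and lip: "l-lipschitz_on UNIV g" and "l \<le> \<kappa>" and "\<tau> > 0"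
  defines "Z \<equiv> (- \<tau>) *\<^sub>R L_stab L \<kappa>"
  shows "energy L G v - energy L G w
     \<le> - (1 / \<tau>) * ((v - w) \<bullet> (\<tau> *\<^sub>R g_stab g \<kappa> w + Z *v w + (1/2) *\<^sub>R (Z *v (v - w))))"
proof -
  have Z: "Z *v x = - \<tau> *\<^sub>R (L *v x) - (\<tau> * \<kappa>) *\<^sub>R x" for x
    by (simp add: Z_def L_stab_mult_vec del: scaleR_minus_left)
      simp
  have "(\<lambda>x. - g x) = uminus \<circ> g" by auto
  then have "l-lipschitz_on UNIV (\<lambda>x. - g x)"
    using lip by (simp add: lipschitz_on_def dist_minus)
  from descent_lemma[OF grad this, of v w]
  have "G v \<bullet> 1 - G w \<bullet> 1 \<le> - (g w \<bullet> (v - w)) + l / 2 * ((v - w) \<bullet> (v - w))"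
    by (simp add: power2_norm_eq_inner)
  also have "\<dots> \<le> - (g w \<bullet> (v - w)) + \<kappa> / 2 * ((v - w) \<bullet> (v - w))"
    using \<open>l \<le> \<kappa>\<close> by (intro add_left_mono mult_right_mono) auto
  finally have "energy L G v - energy L G w \<le> 1/2 * (v \<bullet> (L *v v)) - 1/2 * (w \<bullet> (L *v w))
     - g w \<bullet> (v - w) + \<kappa> / 2 * ((v - w) \<bullet> (v - w))"
    by (simp add: energy_def)
  also have "\<dots> = - ((v - w) \<bullet> ((g w + \<kappa> *\<^sub>R w) + (- (L *v w) - \<kappa> *\<^sub>R w)
       + (1/2) *\<^sub>R (- (L *v (v - w)) - \<kappa> *\<^sub>R (v - w))))"
    using inner_symmetric_matrix[OF sym, of v w]
    by (simp add: matrix_vector_mult_diff_distrib inner_simps inner_commute algebra_simps)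
  also have "\<dots> = - (1 / \<tau>) * ((v - w) \<bullet>
       (\<tau> *\<^sub>R ((g w + \<kappa> *\<^sub>R w) + (- (L *v w) - \<kappa> *\<^sub>R w)
       + (1/2) *\<^sub>R (- (L *v (v - w)) - \<kappa> *\<^sub>R (v - w)))))"
    using \<open>\<tau> > 0\<close> by simp
  also have "\<tau> *\<^sub>R ((g w + \<kappa> *\<^sub>R w) + (- (L *v w) - \<kappa> *\<^sub>R w)
       + (1/2) *\<^sub>R (- (L *v (v - w)) - \<kappa> *\<^sub>R (v - w)))
     = \<tau> *\<^sub>R g_stab g \<kappa> w + Z *v w + (1/2) *\<^sub>R (Z *v (v - w))"
    by (simp add: Z g_stab_def vec_eq_iff algebra_simps)
  finally show ?thesis .
qed

section \<open>Spectral coordinates\<close>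

text \<open>Passing to \<open>H v = transpose Q *v v\<close> makes every function of
  \<open>A\<close> act as a scalar in each coordinate. Injectivity lets vector identities be checked
  coordinatewise, and the eigenvector clause gives access to the sign of \<open>d i\<close>.\<close>

lemma spectral_coordinates:
  fixes A :: "real^'m^'m"
  assumes "transpose A = A"
  obtains H :: "real^'m \<Rightarrow> real^'m" and d
  where "linear H" "inj H"
    and "\<And>f v i. H (matfun f A *v v) $ i = f (d i) * H v $ i"
    and "\<And>v i. H (A *v v) $ i = d i * H v $ i"
    and "\<And>v w. v \<bullet> w = (\<Sum>i\<in>UNIV. H v $ i * H w $ i)"
    and "\<And>i. \<exists>v. v \<noteq> 0 \<and> A *v v = d i *\<^sub>R v"
proof -
  obtain Q d where Q: "orthogonal_matrix Q" and A: "A = Q ** diag_mat d ** transpose Q"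
    using symmetric_diagonalizable[OF assms] .
  have QQ: "transpose Q ** Q = mat 1" "Q ** transpose Q = mat 1"
    using Q by (auto simp: orthogonal_matrix_def)
  define H where "H v = transpose Q *v v" for v
  have diag: "H ((Q ** diag_mat e ** transpose Q) *v v) $ i = e i * H v $ i" for e v i
  proof -
    have "H ((Q ** diag_mat e ** transpose Q) *v v) = diag_mat e *v H v"
      unfolding H_def by (metis QQ(1) matrix_mul_assoc matrix_mul_lid matrix_vector_mul_assoc)
    then show ?thesis
      by (simp add: matrix_vector_mult_def diag_mat_def if_distrib if_distribR cong: if_cong)
  qed
  have inner: "v \<bullet> w = H v \<bullet> H w" for v w
  proof -
    have "H v \<bullet> H w = v \<bullet> (Q *v H w)"
      by (simp add: H_def dot_lmul_matrix)
    then show ?thesis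
      unfolding H_def by (simp add: matrix_vector_mul_assoc QQ del: transpose_matrix_vector)
  qed
  have lin: "linear H" unfolding H_def by (rule matrix_vector_mul_linear)
  have inj: "inj H"
    unfolding linear_injective_0[OF lin] by (metis inner inner_eq_zero_iff)
  show thesis
  proof (rule that[OF lin inj])
    show "H (matfun f A *v v) $ i = f (d i) * H v $ i" for f v i
      by (simp add: matfun_eq[OF Q A] diag)
    show HA: "H (A *v v) $ i = d i * H v $ i" for v i
      by (simp add: A diag)
    show "v \<bullet> w = (\<Sum>i\<in>UNIV. H v $ i * H w $ i)" for v w
      unfolding inner[of v w] by (simp add: inner_vec_def)
    show "\<exists>v. v \<noteq> 0 \<and> A *v v = d i *\<^sub>R v" for i
    proof -
      \<comment> \<open>This is column \<open>i\<close> of \<open>Q\<close>.\<close>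
      define v where "v = Q *v axis i 1"
      have Hv: "H v = axis i 1"
        unfolding H_def v_def
          by (simp add: matrix_vector_mul_assoc QQ del: transpose_matrix_vector)
      have "H (A *v v) = H (d i *\<^sub>R v)"
        by (simp add: vec_eq_iff HA linear_scale[OF lin] Hv axis_def)
      moreover have "v \<noteq> 0"
        using Hv linear_0[OF lin] by (auto simp: axis_eq_0_iff)
      ultimately show ?thesis using inj by (auto dest: injD)
    qed
  qed
qed

section \<open>Positivity of the differential form\<close>

lemma phi_1_nonzero: "z \<noteq> 0 \<Longrightarrow> phi 1 z = (exp z - 1) / z"
  by simp

lemma phi_2_nonzero: "z \<noteq> 0 \<Longrightarrow> phi 2 z = (exp z - 1 - z) / z\<^sup>2"
  by (simp add: numeral_2_eq_2 field_simps)

lemma phi_pos: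
  fixes z :: real
  assumes "z < 0"
  shows "phi 1 z > 0" "phi 2 z > 0"
  using assms exp_minus_greater[of "- z"]
  by (simp_all add: phi_1_nonzero phi_2_nonzero divide_neg_neg del: phi.simps One_nat_def)

lemma eerk2_discriminant:
  fixes c x :: real
  assumes "c \<in> {1/2..1}" and "x > 0"
  defines "p \<equiv> exp (- (c * x))" and "q \<equiv> exp (- x)"
  defines "s \<equiv> x - 1 + q"
  shows "s\<^sup>2 + (c * x)\<^sup>2 * (p - q)\<^sup>2 \<le> 2 * (c * x) * s * (1 - p * q)"
proof -
  \<comment> \<open>\<open>t\<close> is the square root of \<open>q\<close> and \<open>r\<close> is
    the quotient \<open>q / p\<close>; \<open>c \<le> 1\<close> gives \<open>r \<le> 1\<close>, and
    \<open>c \<ge> 1/2\<close> gives \<open>p \<le> t\<close>.\<close>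
  define t r where "t = exp (- (x / 2))" and "r = exp (- (x - c * x))"
  have pos: "p > 0" "q > 0" "t > 0" "r > 0" by (simp_all add: p_def q_def t_def r_def)
  have q: "q = t\<^sup>2" by (simp add: q_def t_def power2_eq_square exp_add[symmetric])
  have pr: "p * r = q" by (simp add: p_def q_def r_def exp_add[symmetric])
  have cx: "c * x \<ge> x / 2" "c * x \<le> x" using assms by (auto simp: field_simps)
  have pt: "p \<le> t" unfolding p_def t_def using cx by simp
  have r1: "r \<le> 1" "p \<le> 1" "t < 1" unfolding r_def p_def t_def using cx assms by auto
  have mul_exp_le: "h * exp (- h) \<le> 1 - exp (- h)" for h :: real
    using exp_ge_add_one_self[of h] by (simp add: exp_minus field_simps)
  have ht: "x / 2 * t \<le> 1 - t" using mul_exp_le[of "x / 2"] by (simp add: t_def)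
  have t_ge: "t \<ge> 1 - x / 2" using exp_ge_add_one_self[of "- (x / 2)"] by (simp add: t_def)
  \<comment> \<open>The difference of the two sides is \<open>x - 2 + 2 * t\<close>.\<close>
  have s_ge: "(1 - t)\<^sup>2 \<le> s"
    using t_ge by (simp add: s_def q power2_eq_square algebra_simps)
  have s0: "s > 0" using s_ge r1 by (smt (verit) zero_less_power2)
  have a0: "0 \<le> c * x * (p - q)"
    using cx assms pos r1 pr by (intro mult_nonneg_nonneg) (auto simp: mult_left_le)
  \<comment> \<open>\<open>p * r = t\<^sup>2\<close>, so \<open>p + r \<ge> 2 * t\<close>.\<close>
  have a_le: "c * x * (p - q) \<le> (1 - t)\<^sup>2"
  proof -
    have "c * x * (p - q) = (c * x * p) * (1 - r)" by (simp add: pr[symmetric] algebra_simps)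
    also have "\<dots> \<le> (1 - p) * (1 - r)"
      using mul_exp_le[of "c * x"] r1 by (intro mult_right_mono) (auto simp: p_def)
    also have "\<dots> = 1 + t\<^sup>2 - (p + r)" by (simp add: pr q[symmetric] algebra_simps)
    also have "\<dots> \<le> 1 + t\<^sup>2 - 2 * t"
    proof -
      have "(2 * t)\<^sup>2 \<le> (p + r)\<^sup>2"
        using zero_le_power2[of "p - r"] unfolding power_mult_distrib q[symmetric] pr[symmetric]
        by (simp add: power2_eq_square algebra_simps)
      then have "2 * t \<le> p + r" using pos by (intro power2_le_imp_le[of "2 * t" "p + r"]) auto
      then show ?thesis by simp
    qed
    finally show ?thesis by (simp add: power2_eq_square algebra_simps)
  qed
  \<comment> \<open>One factor \<open>c * x * (p - q)\<close> is bounded by \<open>s\<close>, the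
    other by \<open>(1 - t)^2\<close>; then \<open>s\<close> can be factored out of the whole
    left-hand side.\<close>
  have "(c * x)\<^sup>2 * (p - q)\<^sup>2 \<le> s * (1 - t)\<^sup>2"
    using mult_mono[OF order_trans[OF a_le s_ge] a_le] a0 s0
    by (simp add: power2_eq_square mult_ac)
  then have "s\<^sup>2 + (c * x)\<^sup>2 * (p - q)\<^sup>2 \<le> s * (s + (1 - t)\<^sup>2)"
    by (simp add: power2_eq_square algebra_simps)
  \<comment> \<open>The left side equals \<open>x - 2 * t * (1 - t)\<close>, so
    \<open>x * t^3 \<le> 2 * t * (1 - t)\<close> suffices.\<close>
  also have "s + (1 - t)\<^sup>2 \<le> x * (1 - t ^ 3)"
  proof -
    have "x / 2 * t ^ 3 \<le> t * (t * (x / 2 * t))" by (simp add: power3_eq_cube)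
    also have "\<dots> \<le> t * (1 * (1 - t))"
      using ht r1 pos assms by (intro mult_left_mono mult_mono) auto
    finally show ?thesis by (simp add: s_def q power2_eq_square algebra_simps)
  qed
  also have "x * (1 - t ^ 3) \<le> 2 * (c * x) * (1 - p * q)"
  proof (rule mult_mono)
    show "1 - t ^ 3 \<le> 1 - p * q"
      using mult_right_mono[OF pt, of "t\<^sup>2"] by (simp add: q power2_eq_square power3_eq_cube)
    show "0 \<le> 1 - t ^ 3" using r1 pos by (simp add: power_le_one)
  qed (use cx assms in auto)
  finally show ?thesis using s0 by (simp add: mult_ac)
qed

text \<open>With \<open>a\<close> and \<open>b\<close> as coordinates of the two stage differences,
  the second claim is nonnegativity of the quadratic form of \<open>D\<close>. Completing the square
  in \<open>a\<close> leaves the discriminant condition, since the leading coefficient is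
  positive.\<close>

lemma eerk2_d_psd:
  assumes c: "c \<in> {1/2..1}" and z: "z < 0"
  shows "eerk2_d c 1 1 z > 0"
    and "0 \<le> eerk2_d c 1 1 z * a\<^sup>2 + (eerk2_d c 2 1 z * a + eerk2_d c 2 2 z * b) * b"
proof -
  define x where "x = - z"
  have x: "x > 0" "z = - x" using z by (auto simp: x_def)
  define p q s where "p = exp (- (c * x))" and "q = exp (- x)" and "s = x - 1 + q"
  have c0: "c > 0" and cx: "c * x > 0" using c x by auto
  have p1: "0 < p" "p < 1" using cx by (auto simp: p_def)
  have s0: "s > 0" using exp_minus_greater[of x] x by (simp add: s_def q_def)
  have phis: "phi 1 (c * z) = (1 - p) / (c * x)" "phi 1 z = (1 - q) / x" "phi 2 z = s / x\<^sup>2"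
    using c0 x by (simp_all add: phi_1_nonzero phi_2_nonzero p_def q_def s_def
        minus_divide_left add.commute del: phi.simps One_nat_def)
  have d11: "eerk2_d c 1 1 z = x * (1 + p) / (2 * (1 - p))"
    unfolding eerk2_d_def phis using p1 x c0 by (simp add: field_simps)
  have d21: "eerk2_d c 2 1 z = x * (s * p - c * x * (p - q)) / (s * (1 - p))"
    unfolding eerk2_d_def phis using p1 x c0 s0
    by (simp add: field_simps power2_eq_square)
  have d22: "eerk2_d c 2 2 z = x * (2 * (c * x) - s) / (2 * s)"
    unfolding eerk2_d_def phis using p1 x c0 s0
    by (simp add: field_simps power2_eq_square)
  show pos: "eerk2_d c 1 1 z > 0" unfolding d11 using p1 x by simp
  \<comment> \<open>After expansion \<open>s^2 * p^2\<close> cancels, and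
    \<open>1 - p^2 + p * (p - q) = 1 - p * q\<close> recovers the discriminant inequality.\<close>
  have "(s * p - c * x * (p - q))\<^sup>2 \<le> (1 - p\<^sup>2) * (2 * (c * x) - s) * s"
    using eerk2_discriminant[OF c x(1), folded p_def q_def, folded s_def]
    by (simp add: power2_eq_square algebra_simps)
  then have "x\<^sup>2 * (s * p - c * x * (p - q))\<^sup>2 / (s * (1 - p))\<^sup>2
      \<le> x\<^sup>2 * ((1 - p\<^sup>2) * (2 * (c * x) - s) * s) / (s * (1 - p))\<^sup>2"
    by (intro divide_right_mono mult_left_mono) auto
  also have "\<dots> = 4 * eerk2_d c 1 1 z * eerk2_d c 2 2 z"
    unfolding d11 d22 using p1 s0 by (simp add: divide_simps) (simp add: power2_eq_square algebra_simps)
  finally have disc: "(eerk2_d c 2 1 z)\<^sup>2 \<le> 4 * eerk2_d c 1 1 z * eerk2_d c 2 2 z"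
    unfolding d21 by (simp add: power_divide power_mult_distrib)
  let ?q = "eerk2_d c 1 1 z * a\<^sup>2 + (eerk2_d c 2 1 z * a + eerk2_d c 2 2 z * b) * b"
  have "4 * eerk2_d c 1 1 z * ?q = (2 * eerk2_d c 1 1 z * a + eerk2_d c 2 1 z * b)\<^sup>2
     + (4 * eerk2_d c 1 1 z * eerk2_d c 2 2 z - (eerk2_d c 2 1 z)\<^sup>2) * b\<^sup>2"
    by (simp add: power2_eq_square algebra_simps)
  also have "\<dots> \<ge> 0" using disc by (intro add_nonneg_nonneg mult_nonneg_nonneg) auto
  finally show "0 \<le> ?q" using pos by (simp add: zero_le_mult_iff)
qed

text \<open>In terms of the method's coefficients, the entries of \<open>D\<close> take the form
  that results from solving the stage equations for the nonlinear terms.\<close>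

lemma eerk2_d_eq_a:
  assumes "c > 0" and "z < 0"
  shows "eerk2_d c 1 1 z = 1 / eerk2_a c 2 1 z + z / 2"
    and "eerk2_d c 2 1 z = (1 - eerk2_a c 3 1 z / eerk2_a c 2 1 z) / eerk2_a c 3 2 z + z"
    and "eerk2_d c 2 2 z = 1 / eerk2_a c 3 2 z + z / 2"
    and "eerk2_a c 2 1 z > 0" and "eerk2_a c 3 2 z > 0"
proof -
  have cz: "c * z < 0" using assms by (simp add: mult_pos_neg)
  note pos = phi_pos[OF cz] phi_pos[OF \<open>z < 0\<close>]
  show "eerk2_d c 1 1 z = 1 / eerk2_a c 2 1 z + z / 2"
    and "eerk2_d c 2 2 z = 1 / eerk2_a c 3 2 z + z / 2"
    and "eerk2_a c 2 1 z > 0" and "eerk2_a c 3 2 z > 0"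
    using pos assms by (simp_all add: eerk2_d_def eerk2_a_def del: phi.simps One_nat_def)
  show "eerk2_d c 2 1 z = (1 - eerk2_a c 3 1 z / eerk2_a c 2 1 z) / eerk2_a c 3 2 z + z"
  proof -
    define a b e where "a = c * phi 1 (c * z)" and "b = phi 2 z / c" and "e = phi 1 z"
    have "a \<noteq> 0" "b \<noteq> 0" using pos assms by (auto simp: a_def b_def)
    then have "(a - e + b) / (b * a) = (1 - (e - b) / a) / b" by (simp add: field_simps)
    moreover have "phi 2 z * phi 1 (c * z) = b * a"
      using assms by (simp add: a_def b_def del: phi.simps)
    ultimately show ?thesis
      by (simp add: eerk2_d_def eerk2_a_def a_def b_def e_def del: phi.simps One_nat_def)
  qed
qed

section \<open>Energy dissipation\<close>

theorem corollary3p1: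
  fixes L :: "real^'m^'m" and G g :: "real^'m \<Rightarrow> real^'m"
    and c\<^sub>2 \<kappa> l\<^sub>g \<tau> :: real
    and u :: "nat \<Rightarrow> real^'m" and U :: "nat \<Rightarrow> nat \<Rightarrow> real^'m"
  assumes "spd L"
    and "\<And>v i. 0 \<le> G v $ i"
    and "\<And>v. GDERIV (\<lambda>w. G w \<bullet> 1) v :> - g v"
    and "l\<^sub>g > 0" and "l\<^sub>g-lipschitz_on UNIV g"
    and "\<kappa> \<ge> 2 * l\<^sub>g"
    and "c\<^sub>2 \<in> {1/2..1}"
    and "\<tau> > 0"
    and "eerk2_solution L g \<kappa> c\<^sub>2 \<tau> u U"
  shows "\<forall>n\<ge>1. \<forall>j\<in>{1,2}.
           energy L G (U n (j + 1)) - energy L G (U n 1)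
             \<le> - (1 / \<tau>) * (\<Sum>k=1..j. stage_diff (U n) (k + 1) \<bullet>
                  (\<Sum>l=1..k. matfun (eerk2_d c\<^sub>2 k l) ((- \<tau>) *\<^sub>R L_stab L \<kappa>) *v
                     stage_diff (U n) (l + 1))) \<and>
           - (1 / \<tau>) * (\<Sum>k=1..j. stage_diff (U n) (k + 1) \<bullet>
                  (\<Sum>l=1..k. matfun (eerk2_d c\<^sub>2 k l) ((- \<tau>) *\<^sub>R L_stab L \<kappa>) *v
                     stage_diff (U n) (l + 1))) \<le> 0"
proof (intro allI impI ballI)
  fix n j :: nat
  assume n: "n \<ge> 1" and j: "j \<in> {1, 2}"
  define V where "V = U n"
  define Z where "Z = (- \<tau>) *\<^sub>R L_stab L \<kappa>"
  define v w where "v = V 2 - V 1" and "w = V 3 - V 2"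
  define D where "D k l = matfun (eerk2_d c\<^sub>2 k l) Z" for k l
  have c: "c\<^sub>2 > 0" using assms(7) by auto
  have symL: "transpose L = L" using assms(1) by (simp add: spd_def)
  have Zv: "Z *v x = - \<tau> *\<^sub>R (L *v x) - (\<tau> * \<kappa>) *\<^sub>R x" for x
    by (simp add: Z_def L_stab_mult_vec del: scaleR_minus_left)
      simp
  have "transpose Z = Z"
  proof -
    have "L $ i $ j = L $ j $ i" for i j
      using arg_cong[OF symL, of "\<lambda>A. A $ j $ i"] by (simp add: transpose_def)
    then show ?thesis
      unfolding vec_eq_iff transpose_def Z_def L_stab_def mat_def by auto
  qed
  then obtain H :: "real^'m \<Rightarrow> real^'m" and d where lin: "linear H" and inj: "inj H"
    and Hf: "\<And>f v i. H (matfun f Z *v v) $ i = f (d i) * H v $ i"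
    and HZ: "\<And>v i. H (Z *v v) $ i = d i * H v $ i"
    and Hi: "\<And>v w. v \<bullet> w = (\<Sum>i\<in>UNIV. H v $ i * H w $ i)"
    and eig: "\<And>i. \<exists>v. v \<noteq> 0 \<and> Z *v v = d i *\<^sub>R v"
    by (rule spectral_coordinates) (rule that)
  note H = linear_add[OF lin] linear_diff[OF lin] linear_scale[OF lin] Hf HZ
  \<comment> \<open>Pairing an eigenvector with its equation reduces the sign to positive
    definiteness of \<open>L\<close> and \<open>\<kappa> > 0\<close>. The scalar lemmas apply to
    negative arguments only.\<close>
  have d: "d i < 0" for i
  proof -
    obtain x where x: "x \<noteq> 0" "Z *v x = d i *\<^sub>R x" using eig by blast
    have "d i * (x \<bullet> x) = x \<bullet> (Z *v x)" by (simp add: x)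
    also have "\<dots> = - (\<tau> * (x \<bullet> (L *v x) + \<kappa> * (x \<bullet> x)))"
      by (simp add: Zv inner_diff_right algebra_simps)
    also have "\<dots> < 0"
      using assms(1,4,6,8) x by (simp add: spd_def add_pos_nonneg)
    finally show ?thesis using inner_ge_zero[of x] by (auto simp only: mult_less_0_iff)
  qed
  note da = eerk2_d_eq_a[OF c d]
  have ZL: "\<tau> *\<^sub>R x - \<tau> *\<^sub>R (L_stab L \<kappa> *v y) = \<tau> *\<^sub>R x + Z *v y" for x y
    unfolding Z_def scaleR_matrix_vector_assoc[symmetric] by simp
  have stages:
    "V 2 = V 1 + matfun (eerk2_a c\<^sub>2 2 1) Z *v (\<tau> *\<^sub>R g_stab g \<kappa> (V 1) + Z *v V 1)"
    "V 3 = V 1 + (matfun (eerk2_a c\<^sub>2 3 1) Z *v (\<tau> *\<^sub>R g_stab g \<kappa> (V 1) + Z *v V 1)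
       + matfun (eerk2_a c\<^sub>2 3 2) Z *v (\<tau> *\<^sub>R g_stab g \<kappa> (V 2) + Z *v V 1))"
    using assms(9) n
    unfolding eerk2_solution_def V_def Z_def[symmetric] ZL
    by (simp_all add: numeral_2_eq_2 numeral_3_eq_3)
  define r1 r2 where "r1 = \<tau> *\<^sub>R g_stab g \<kappa> (V 1) + Z *v V 1"
    and "r2 = \<tau> *\<^sub>R g_stab g \<kappa> (V 2) + Z *v V 1"
  have Hv: "H v $ i = eerk2_a c\<^sub>2 2 1 (d i) * H r1 $ i" for i
    unfolding v_def stages(1) by (simp add: H r1_def)
  \<comment> \<open>The stage equation gives \<open>V 3 - V 1\<close>; subtracting \<open>v\<close>
    turns it into \<open>w\<close>.\<close>
  have Hw: "H w $ i = eerk2_a c\<^sub>2 3 1 (d i) * H r1 $ i + eerk2_a c\<^sub>2 3 2 (d i) * H r2 $ i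
      - H v $ i" for i
    unfolding w_def v_def stages(2) by (simp add: H r1_def r2_def)
  have res1: "\<tau> *\<^sub>R g_stab g \<kappa> (V 1) + Z *v V 1 + (1/2) *\<^sub>R (Z *v v) = D 1 1 *v v"
  proof (rule injD[OF inj], unfold vec_eq_iff, rule allI)
    fix i
    have "H r1 $ i = H v $ i / eerk2_a c\<^sub>2 2 1 (d i)"
      using da(4)[of i] by (simp add: Hv)
    then show "H (\<tau> *\<^sub>R g_stab g \<kappa> (V 1) + Z *v V 1 + (1/2) *\<^sub>R (Z *v v)) $ i = H (D 1 1 *v v) $ i"
      unfolding r1_def[symmetric] D_def by (simp add: H da(1) distrib_right del: One_nat_def)
  qed
  have res2: "\<tau> *\<^sub>R g_stab g \<kappa> (V 2) + Z *v V 2 + (1/2) *\<^sub>R (Z *v w) = D 2 1 *v v + D 2 2 *v w"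
  proof (rule injD[OF inj], unfold vec_eq_iff, rule allI)
    fix i
    have r1: "H r1 $ i = H v $ i / eerk2_a c\<^sub>2 2 1 (d i)"
      using da(4)[of i] by (simp add: Hv)
    have r2: "H r2 $ i = (H w $ i + H v $ i - eerk2_a c\<^sub>2 3 1 (d i) * H r1 $ i) / eerk2_a c\<^sub>2 3 2 (d i)"
      using da(5)[of i] by (simp add: Hw)
    \<comment> \<open>\<open>r2\<close> contains \<open>Z *v V 1\<close>, but the residual at
      \<open>V 2\<close> needs \<open>Z *v V 2\<close>. The gap \<open>Z *v v\<close> is the source
      of the summand \<open>z\<close> in the entry (2,1) of \<open>D\<close>.\<close>
    have "\<tau> *\<^sub>R g_stab g \<kappa> (V 2) + Z *v V 2 + (1/2) *\<^sub>R (Z *v w) = r2 + Z *v v + (1/2) *\<^sub>R (Z *v w)"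
      by (simp add: r2_def v_def matrix_vector_mult_diff_distrib)
    then show "H (\<tau> *\<^sub>R g_stab g \<kappa> (V 2) + Z *v V 2 + (1/2) *\<^sub>R (Z *v w)) $ i
        = H (D 2 1 *v v + D 2 2 *v w) $ i"
      using da(4,5)[of i] unfolding D_def
      by (simp add: H da(2,3) r2 r1 field_simps del: One_nat_def)
  qed
  have "l\<^sub>g \<le> \<kappa>" using assms(4,6) by linarith
  note step = energy_diff_le[OF symL assms(3,5) this assms(8), folded Z_def]
  have e1: "energy L G (V 2) - energy L G (V 1) \<le> - (1 / \<tau>) * (v \<bullet> (D 1 1 *v v))"
    using step[of "V 2" "V 1"] by (simp only: v_def[symmetric] res1)
  have e2: "energy L G (V 3) - energy L G (V 2)
      \<le> - (1 / \<tau>) * (w \<bullet> (D 2 1 *v v + D 2 2 *v w))"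
    using step[of "V 3" "V 2"] by (simp only: w_def[symmetric] res2)
  have psd1: "0 \<le> v \<bullet> (D 1 1 *v v)"
    unfolding Hi D_def H
    using eerk2_d_psd(1)[OF assms(7) d]
    by (intro sum_nonneg) (simp add: mult.left_commute[of _ "eerk2_d _ _ _ _"] less_imp_le del: One_nat_def)
  \<comment> \<open>The second residual alone need not have a sign: the mixed term is controlled
    only together with the first stage's square, coordinate by coordinate.\<close>
  have psd2: "0 \<le> v \<bullet> (D 1 1 *v v) + w \<bullet> (D 2 1 *v v + D 2 2 *v w)"
    unfolding Hi D_def H sum.distrib[symmetric] vector_add_component
    using eerk2_d_psd(2)[OF assms(7) d]
    by (intro sum_nonneg) (simp add: power2_eq_square algebra_simps del: One_nat_def)
  have diffs: "stage_diff V 2 = v" "stage_diff V 3 = w"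
    by (simp_all add: stage_diff_def v_def w_def)
  define S where "S = (\<Sum>k=1..j. stage_diff V (k + 1) \<bullet>
      (\<Sum>l=1..k. D k l *v stage_diff V (l + 1)))"
  have "energy L G (V (j + 1)) - energy L G (V 1) \<le> - (1 / \<tau>) * S \<and> 0 \<le> S"
  proof (cases "j = 1")
    case True
    then have "S = v \<bullet> (D 1 1 *v v)" using diffs by (simp add: S_def numeral_2_eq_2)
    then show ?thesis using True e1 psd1 by (simp add: numeral_2_eq_2)
  next
    case False
    then have j2: "j = 2" using j by simp
    have S: "S = v \<bullet> (D 1 1 *v v) + w \<bullet> (D 2 1 *v v + D 2 2 *v w)"
      using diffs by (simp add: S_def j2 numeral_2_eq_2 numeral_3_eq_3)
    have "energy L G (V 3) - energy L G (V 1) \<le> - (1 / \<tau>) * S"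
      \<comment> \<open>The two one-stage estimates telescope.\<close>
      using add_mono[OF e1 e2] unfolding S distrib_left by linarith
    then show ?thesis using psd2 by (simp add: j2 S numeral_3_eq_3)
  qed
  then have "energy L G (V (j + 1)) - energy L G (V 1) \<le> - (1 / \<tau>) * S \<and> - (1 / \<tau>) * S \<le> 0"
    using assms(8) by simp
  then show "energy L G (U n (j + 1)) - energy L G (U n 1)
             \<le> - (1 / \<tau>) * (\<Sum>k=1..j. stage_diff (U n) (k + 1) \<bullet>
                  (\<Sum>l=1..k. matfun (eerk2_d c\<^sub>2 k l) ((- \<tau>) *\<^sub>R L_stab L \<kappa>) *v
                     stage_diff (U n) (l + 1))) \<and>
           - (1 / \<tau>) * (\<Sum>k=1..j. stage_diff (U n) (k + 1) \<bullet>
                  (\<Sum>l=1..k. matfun (eerk2_d c\<^sub>2 k l) ((- \<tau>) *\<^sub>R L_stab L \<kappa>) *v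
                     stage_diff (U n) (l + 1))) \<le> 0"
    unfolding S_def D_def Z_def V_def .
qed

end
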